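(* Let $G=(V,E)$ be a graph satisfying the exponential curvature dimension inequality $CDE(n,0)$. Then any positive harmonic function on $G$ is constant. In particular, bounded harmonic functions on $G$ are constant.
   Context: Graphs: $G=(V,E)$ is a locally finite, connected graph with a symmetric weight $\mu_{\cdot\cdot}:V\times V\to[0,\infty)$, $\mu_{xy}>0$ iff $x\sim y$ (neighbors), $\inf_{(x,y)\in E}\mu_{xy}>0$, $\deg(x):=\sum_{y}\mu_{xy}<\infty$. $m:V\to(0,\infty)$ is a measure on vertices. $D_\mu:=\max_{(x,y)\in E}\deg(x)/\mu_{xy}$ and $D_m:=\max_{x\in V}\deg(x)/m(x)$ are finite. Laplacian: $\Delta f(x)=\frac1{m(x)}\sum_{y}\mu_{xy}(f(y)-f(x))$; $u:V\to\mathbb R$ is harmonic if $\Delta u=0$ on $V$. Curvature: $\Gamma(f,g)=\frac12(\Delta(fg)-f\Delta g-g\Delta f)$, $\Gamma_2(f,g)=\frac12(\Delta\Gamma(f,g)-\Gamma(f,\Delta g)-\Gamma(\Delta f,g))$, $\Gamma(f)=\Gamma(f,f)$, $\Gamma_2(f)=\Gamma_2(f,f)$. For $n>0$ and $\kappa\in\mathbb R$, $G$ satisfies $CDE(n,\kappa)$ if for every vertex $x$ and every positive $f:V\to\mathbb R$ with $\Delta f(x)<0$ one has, at $x$, $\Gamma_2(f)-\Gamma\bigl(f,\frac{\Gamma(f)}{f}\bigr)\ge\frac1n(\Delta f)^2+\kappa\,\Gamma(f)$. *)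

theory Defs
  imports "HOL-Analysis.Analysis"
begin

(* The vertex set is the whole type 'v; an undirected edge is represented by both of its
   ordered pairs.  Loops are permitted. *)
record 'v wgraph =
  edges :: "('v \<times> 'v) set"
  weight :: "'v \<Rightarrow> 'v \<Rightarrow> real"
  vmass :: "'v \<Rightarrow> real"

definition neighbours :: "'v wgraph \<Rightarrow> 'v \<Rightarrow> 'v set" where
  "neighbours G x = {y. (x, y) \<in> edges G}"

(* In a weighted graph (see below) the weight vanishes off the edges and neighbourhoods are
   finite, so sums over all vertices y of terms containing the factor weight G x y are the
   finite sums over the neighbours of x. *)
definition deg :: "'v wgraph \<Rightarrow> 'v \<Rightarrow> real" where
  "deg G x = (\<Sum>y\<in>neighbours G x. weight G x y)"

(* Extended-real valued, so that finiteness of these suprema is a meaningful condition,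
   also when the graph has no edge. *)
definition D_mu :: "'v wgraph \<Rightarrow> ereal" where
  "D_mu G = (SUP (x, y)\<in>edges G. ereal (deg G x / weight G x y))"

definition D_m :: "'v wgraph \<Rightarrow> ereal" where
  "D_m G = (SUP x. ereal (deg G x / vmass G x))"

locale weighted_graph =
  fixes G :: "'v wgraph"
  assumes weight_nonneg: "0 \<le> weight G x y"
    and weight_sym: "weight G x y = weight G y x"
    and weight_pos_iff: "0 < weight G x y \<longleftrightarrow> (x, y) \<in> edges G"
    and locally_finite: "finite (neighbours G x)"
    and connected_graph: "(x, y) \<in> (edges G)\<^sup>*"
    and weight_inf_pos: "0 < (INF (x, y)\<in>edges G. ereal (weight G x y))"
    and vmass_pos: "0 < vmass G x"
    and D_mu_finite: "D_mu G < \<infinity>"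
    and D_m_finite: "D_m G < \<infinity>"

definition laplacian :: "'v wgraph \<Rightarrow> ('v \<Rightarrow> real) \<Rightarrow> 'v \<Rightarrow> real" where
  "laplacian G f x = 1 / vmass G x * (\<Sum>y\<in>neighbours G x. weight G x y * (f y - f x))"

definition harmonic :: "'v wgraph \<Rightarrow> ('v \<Rightarrow> real) \<Rightarrow> bool" where
  "harmonic G u \<longleftrightarrow> (\<forall>x. laplacian G u x = 0)"

definition Gam :: "'v wgraph \<Rightarrow> ('v \<Rightarrow> real) \<Rightarrow> ('v \<Rightarrow> real) \<Rightarrow> 'v \<Rightarrow> real" where
  "Gam G f g x = 1/2 * (laplacian G (\<lambda>y. f y * g y) x
                        - f x * laplacian G g x - g x * laplacian G f x)"

definition Gam2 :: "'v wgraph \<Rightarrow> ('v \<Rightarrow> real) \<Rightarrow> ('v \<Rightarrow> real) \<Rightarrow> 'v \<Rightarrow> real" where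
  "Gam2 G f g x = 1/2 * (laplacian G (Gam G f g) x
                         - Gam G f (laplacian G g) x - Gam G (laplacian G f) g x)"

definition CDE :: "'v wgraph \<Rightarrow> real \<Rightarrow> real \<Rightarrow> bool" where
  "CDE G n \<kappa> \<longleftrightarrow>
     (\<forall>x f. (\<forall>y. 0 < f y) \<longrightarrow> laplacian G f x < 0 \<longrightarrow>
        Gam2 G f f x - Gam G f (\<lambda>y. Gam G f f y / f y) x
          \<ge> 1 / n * (laplacian G f x)\<^sup>2 + \<kappa> * Gam G f f x)"

end

(* For f = sqrt u with u harmonic and positive, the identity 2 Gam(f) = Lap(f^2) - 2 f Lap(f)
   reads Gam(f)/f = - Lap(f), so the two curvature terms of CDE combine to 1/2 Lap(Gam(f)), and
   CDE(n,0) becomes Lap(Gam(f)) >= (2/n) Gam(f)^2 / u.  Put F = Gam(f)/u, which is bounded by D_m.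
   As u is harmonic, Lap(u F) = u L F, where L is the Markov generator with jump rates
   weight x y * u y / (vmass x * u x), whose total rate at x is deg x / vmass x, hence bounded.
   Thus L F >= (2/n) F^2; evaluating this where F is nearly maximal forces F = 0. *)
theory Submission
  imports Defs
begin

context weighted_graph
begin

lemma vmass_neq_0 [simp]: "vmass G x \<noteq> 0"
  using vmass_pos[of x] by simp

text \<open>Turns finiteness of \<open>D_m G\<close> into a real bound on the total jump rate;
  \<open>C\<close> is taken positive so that one may divide by it.\<close>

lemma deg_le_mult_vmass:
  obtains C where "0 < C" "\<And>x. deg G x \<le> C * vmass G x"
proof -
  obtain c where c: "D_m G \<le> ereal c"
    using D_m_finite less_PInf_Ex_of_nat[of "D_m G"] by (auto intro: less_imp_le)
  show thesis
  proof
    show "0 < max c 1" by simp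
    fix x
    have "ereal (deg G x / vmass G x) \<le> D_m G"
      unfolding D_m_def by (rule SUP_upper) simp
    then have "deg G x / vmass G x \<le> max c 1"
      using c by (meson ereal_less_eq(3) max.coboundedI1 order_trans)
    then show "deg G x \<le> max c 1 * vmass G x"
      using vmass_pos[of x] by (simp add: pos_divide_le_eq)
  qed
qed

lemma harmonic_sum:
  assumes "harmonic G u"
  shows "(\<Sum>y\<in>neighbours G x. weight G x y * u y) = deg G x * u x"
  using assms[unfolded harmonic_def, rule_format, of x]
  by (simp add: laplacian_def deg_def right_diff_distrib sum_subtractf sum_distrib_right)

lemma harmonic_add_const:
  assumes "harmonic G u"
  shows "harmonic G (\<lambda>x. u x + c)"
  using assms by (simp add: harmonic_def laplacian_def)

text \<open>Harmonicity rewrites \<open>deg G x * u x\<close> as the sum of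
  \<open>weight G x y * u y\<close>, so \<open>F y\<close> and \<open>F x\<close> occur with the
  same coefficients and only differences of \<open>F\<close> remain.\<close>

lemma laplacian_times_harmonic:
  assumes "harmonic G u"
  shows "laplacian G (\<lambda>y. u y * F y) x =
         1 / vmass G x * (\<Sum>y\<in>neighbours G x. weight G x y * u y * (F y - F x))"
proof -
  have "(\<Sum>y\<in>neighbours G x. weight G x y * (u y * F y - u x * F x)) =
        (\<Sum>y\<in>neighbours G x. weight G x y * u y * F y) - deg G x * u x * F x"
    by (simp add: deg_def sum_distrib_right right_diff_distrib sum_subtractf mult.assoc)
  also have "\<dots> = (\<Sum>y\<in>neighbours G x. weight G x y * u y * (F y - F x))"
    by (simp add: right_diff_distrib sum_subtractf harmonic_sum[OF assms, symmetric]
        sum_distrib_right)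
  finally show ?thesis by (simp add: laplacian_def)
qed

text \<open>Termwise this is a^2 - b^2 - 2b(a - b) = (a - b)^2. Both nonnegativity of
  \<open>Gam G f f\<close> and the meaning of its vanishing are read off from it.\<close>

lemma Gam_self:
  "Gam G f f x = 1 / (2 * vmass G x) * (\<Sum>y\<in>neighbours G x. weight G x y * (f y - f x)\<^sup>2)"
proof -
  have "(\<Sum>y\<in>neighbours G x. weight G x y * (f y * f y - f x * f x))
        - 2 * (f x * (\<Sum>y\<in>neighbours G x. weight G x y * (f y - f x)))
      = (\<Sum>y\<in>neighbours G x. weight G x y * (f y - f x)\<^sup>2)"
    unfolding sum_distrib_left sum_subtractf[symmetric]
    by (rule sum.cong) (auto simp: power2_eq_square algebra_simps)
  then show ?thesis
    by (simp add: Gam_def laplacian_def field_simps)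
qed

lemma Gam_nonneg: "0 \<le> Gam G f f x"
  unfolding Gam_self using vmass_pos[of x]
  by (intro mult_nonneg_nonneg sum_nonneg) (auto simp: weight_nonneg less_imp_le)

lemma Gam_commute: "Gam G f g = Gam G g f"
  by (rule ext) (simp add: Gam_def mult.commute)

lemma Gam_minus_right: "Gam G f (\<lambda>y. - g y) x = - Gam G f g x"
proof -
  have "laplacian G (\<lambda>y. - h y) x = - laplacian G h x" for h
    unfolding laplacian_def by (simp add: right_diff_distrib sum_subtractf sum_negf)
  then show ?thesis
    by (simp add: Gam_def field_simps)
qed

text \<open>Dropping the cross term of the square leaves \<open>u y + u x\<close>, and by
  harmonicity both summands contribute \<open>deg G x * u x\<close>. This is what bounds F.\<close>

lemma Gam_sqrt_le:
  assumes "harmonic G u" "\<And>x. 0 < u x"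
  shows "vmass G x * Gam G (\<lambda>y. sqrt (u y)) (\<lambda>y. sqrt (u y)) x \<le> deg G x * u x"
proof -
  let ?f = "\<lambda>y. sqrt (u y)"
  have "(?f y - ?f x)\<^sup>2 \<le> u y + u x" for y
    using assms(2)[of x] assms(2)[of y] by (simp add: power2_diff)
  then have "(\<Sum>y\<in>neighbours G x. weight G x y * (?f y - ?f x)\<^sup>2)
      \<le> (\<Sum>y\<in>neighbours G x. weight G x y * (u y + u x))"
    by (intro sum_mono mult_left_mono) (auto simp: weight_nonneg)
  also have "\<dots> = 2 * (deg G x * u x)"
    by (simp add: distrib_left sum.distrib harmonic_sum[OF assms(1)] deg_def
        flip: sum_distrib_right)
  finally show ?thesis
    unfolding Gam_self by simp
qed

text \<open>\<open>CDE\<close> speaks only of points where the Laplacian of \<open>f\<close> is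
  negative. Since \<open>Gam G f f\<close> equals minus \<open>f\<close> times that Laplacian, the
  remaining points are the zeros of \<open>Gam G f f\<close>, which are treated directly.\<close>

lemma CDE_harmonic_square:
  assumes "CDE G n 0" and f: "\<And>y. 0 < f y" and h: "harmonic G (\<lambda>y. f y * f y)"
  shows "2 / n * (Gam G f f x / f x)\<^sup>2 \<le> laplacian G (Gam G f f) x"
proof -
  have G: "Gam G f f y = - (f y * laplacian G f y)" for y
    using h by (simp add: Gam_def harmonic_def)
  have Q: "Gam G f f y / f y = - laplacian G f y" for y
    using f[of y] by (simp add: G)
  show ?thesis
  proof (cases "Gam G f f x = 0")
    case True
    \<comment> \<open>The nonnegative function \<open>Gam G f f\<close> attains its minimum 0 at
      \<open>x\<close>.\<close>
    have "0 \<le> laplacian G (Gam G f f) x"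
      unfolding laplacian_def True using vmass_pos[of x]
      by (intro mult_nonneg_nonneg sum_nonneg) (auto simp: weight_nonneg Gam_nonneg less_imp_le)
    with True show ?thesis by simp
  next
    case False
    then have "laplacian G f x < 0"
      using Gam_nonneg[of f x] f[of x] by (simp add: G zero_less_mult_iff mult_le_0_iff)
    then have "1 / n * (laplacian G f x)\<^sup>2
        \<le> Gam2 G f f x - Gam G f (\<lambda>y. Gam G f f y / f y) x"
      using assms(1) f unfolding CDE_def by fastforce
    \<comment> \<open>The two mixed terms of \<open>Gam2\<close> agree by symmetry and together
      cancel against \<open>Gam G f\<close> applied to minus the Laplacian of
      \<open>f\<close>.\<close>
    also have "\<dots> = 1 / 2 * laplacian G (Gam G f f) x"
      unfolding Q Gam_minus_right Gam2_def
      using fun_cong[OF Gam_commute[of "laplacian G f" f]] by (simp add: field_simps)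
    finally show ?thesis by (simp add: Q mult.commute)
  qed
qed

text \<open>The supremum \<open>S\<close> of \<open>F\<close> need not be attained, so the
  inequality is evaluated at a point \<open>z\<close> with \<open>F z\<close> within
  \<open>e\<close> of \<open>S\<close>. No jump from \<open>z\<close> raises \<open>F\<close> by
  more than \<open>e\<close>, so the right side is at most \<open>u z * (C * e)\<close>, too small
  for the left side if \<open>S\<close> is positive.\<close>

lemma maximum_principle:
  assumes u: "harmonic G u" "\<And>x. 0 < u x" and "0 < c"
    and F: "bdd_above (range F)"
    and L: "\<And>x. c * (u x * (F x)\<^sup>2) \<le> laplacian G (\<lambda>y. u y * F y) x"
  shows "F x \<le> 0"
proof (rule ccontr)
  assume "\<not> F x \<le> 0"
  define S where "S = Sup (range F)"
  have FS: "F y \<le> S" for y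
    unfolding S_def using F by (auto intro: cSUP_upper)
  have S: "0 < S"
    using FS[of x] \<open>\<not> F x \<le> 0\<close> by simp
  obtain C where C: "0 < C" "\<And>x. deg G x \<le> C * vmass G x"
    using deg_le_mult_vmass by blast
  \<comment> \<open>The first bound gives \<open>F z > S / 2\<close>, hence a quadratic term of at
    least \<open>c * S\<^sup>2 / 4\<close>; the second keeps \<open>C * e\<close> at half of
    that.\<close>
  define e where "e = min (S / 2) (c * S\<^sup>2 / (8 * C))"
  have e: "0 < e" "e \<le> S / 2" "C * e \<le> c * S\<^sup>2 / 8"
    using S C(1) \<open>0 < c\<close> by (auto simp: e_def min_def field_simps)
  obtain z where z: "S - e < F z"
    using less_cSupD[of "range F" "S - e"] e(1) by (auto simp: S_def)
  have "(\<Sum>y\<in>neighbours G z. weight G z y * u y * (F y - F z))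
      \<le> (\<Sum>y\<in>neighbours G z. weight G z y * u y * e)"
  proof (intro sum_mono mult_left_mono)
    show "F y - F z \<le> e" for y using FS[of y] z by simp
    show "0 \<le> weight G z y * u y" for y
      using weight_nonneg u(2)[of y] by (simp add: less_imp_le)
  qed
  also have "\<dots> = deg G z * (u z * e)"
    by (simp add: harmonic_sum[OF u(1)] flip: sum_distrib_right)
  also have "\<dots> \<le> C * vmass G z * (u z * e)"
    using C(2) u(2)[of z] e(1) by (intro mult_right_mono) auto
  finally have "laplacian G (\<lambda>y. u y * F y) z \<le> u z * (C * e)"
    unfolding laplacian_times_harmonic[OF u(1)]
    using vmass_pos[of z] by (simp add: field_simps)
  with L[of z] have "u z * (c * (F z)\<^sup>2) \<le> u z * (C * e)"
    by (simp add: algebra_simps)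
  then have "c * (F z)\<^sup>2 \<le> C * e"
    using u(2)[of z] by (simp only: mult_le_cancel_left_pos)
  moreover have "c * (S / 2)\<^sup>2 \<le> c * (F z)\<^sup>2"
    using z e(2) S \<open>0 < c\<close> by (intro mult_left_mono power_mono) auto
  ultimately have "c * S\<^sup>2 / 4 \<le> c * S\<^sup>2 / 8"
    using e(3) by (simp add: power_divide)
  moreover have "0 < c * S\<^sup>2"
    using S \<open>0 < c\<close> by simp
  ultimately show False by simp
qed

text \<open>A vanishing sum of nonnegative terms forces \<open>f\<close> to agree across every edge,
  as edge weights are positive; connectedness does the rest.\<close>

lemma Gam_eq_0_imp_constant:
  assumes "\<And>x. Gam G f f x = 0"
  shows "f constant_on UNIV"
proof -
  have edge: "f y = f x" if "(x, y) \<in> edges G" for x y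
  proof -
    have "(\<Sum>y\<in>neighbours G x. weight G x y * (f y - f x)\<^sup>2) = 0"
      using assms[of x] by (simp add: Gam_self)
    then have "weight G x y * (f y - f x)\<^sup>2 = 0"
      using that locally_finite[of x]
      by (simp add: sum_nonneg_eq_0_iff weight_nonneg neighbours_def)
    moreover have "0 < weight G x y"
      using that weight_pos_iff by simp
    ultimately show ?thesis by simp
  qed
  have "f y = f x" for x y
    using connected_graph[of x y] by (induction rule: rtrancl_induct) (auto simp: edge)
  then show ?thesis
    unfolding constant_on_def by blast
qed

lemma positive_harmonic_constant:
  assumes n: "0 < n" and "CDE G n 0" and u: "harmonic G u" "\<And>x. 0 < u x"
  shows "u constant_on UNIV"
proof -
  define f where "f = (\<lambda>x. sqrt (u x))"
  have f: "0 < f x" "f x * f x = u x" for x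
    using u(2)[of x] by (auto simp: f_def)
  define F where "F = (\<lambda>x. Gam G f f x / u x)"
  have uF: "(\<lambda>x. u x * F x) = Gam G f f"
    using u(2) by (auto simp: F_def less_imp_neq[symmetric])
  obtain C where C: "0 < C" "\<And>x. deg G x \<le> C * vmass G x"
    using deg_le_mult_vmass by blast
  have "F x \<le> C" for x
  proof -
    have "vmass G x * Gam G f f x \<le> deg G x * u x"
      using Gam_sqrt_le[OF u] by (simp add: f_def)
    also have "\<dots> \<le> C * vmass G x * u x"
      using C(2) u(2)[of x] by (intro mult_right_mono) auto
    finally have "vmass G x * Gam G f f x \<le> vmass G x * (C * u x)"
      by (simp add: algebra_simps)
    then show ?thesis
      using vmass_pos[of x] u(2)[of x] by (simp add: F_def pos_divide_le_eq)
  qed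
  then have bdd: "bdd_above (range F)"
    by (auto intro!: bdd_aboveI[of _ C])
  have "2 / n * (u x * (F x)\<^sup>2) \<le> laplacian G (\<lambda>y. u y * F y) x" for x
  proof -
    \<comment> \<open>Both sides are the square of \<open>Gam G f f x\<close> divided by
      \<open>u x\<close>, since \<open>f\<close> squares to \<open>u\<close>.\<close>
    have "u x * (F x)\<^sup>2 = (Gam G f f x / f x)\<^sup>2"
      using f(1)[of x] by (simp add: F_def power2_eq_square flip: f(2))
    moreover have "2 / n * (Gam G f f x / f x)\<^sup>2 \<le> laplacian G (Gam G f f) x"
      using assms(2) f(1) u(1) by (intro CDE_harmonic_square) (simp_all add: f(2))
    ultimately show ?thesis by (simp add: uF)
  qed
  then have F: "F x \<le> 0" for x
    using n by (intro maximum_principle[OF u _ bdd, of "2 / n"]) simp_all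
  have "Gam G f f x = 0" for x
    using F[of x] u(2)[of x] Gam_nonneg[of f x] by (auto simp: F_def divide_le_0_iff)
  then have "f constant_on UNIV"
    by (rule Gam_eq_0_imp_constant)
  then show ?thesis
    unfolding constant_on_def using f(2) by metis
qed

end

theorem theorem2p5:
  fixes G :: "'v wgraph" and n :: real
  assumes "weighted_graph G"
    and "n > 0"
    and "CDE G n 0"
  shows "(\<forall>u. harmonic G u \<and> (\<forall>x. 0 < u x) \<longrightarrow> u constant_on UNIV)
       \<and> (\<forall>u. harmonic G u \<and> bounded (range u) \<longrightarrow> u constant_on UNIV)"
proof -
  interpret weighted_graph G by fact
  have "u constant_on UNIV" if u: "harmonic G u" "bounded (range u)" for u
  proof -
    obtain B where B: "\<And>x. \<bar>u x\<bar> \<le> B"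
      using u(2) by (auto simp: bounded_iff)
    \<comment> \<open>Adding \<open>B\<close> alone would give only nonnegativity, as
      \<open>u\<close> may take the value \<open>- B\<close>.\<close>
    have "0 < u x + (B + 1)" for x
      using B[of x] by simp
    then have "(\<lambda>x. u x + (B + 1)) constant_on UNIV"
      using positive_harmonic_constant assms(2,3) harmonic_add_const[OF u(1)] by blast
    then show ?thesis
      unfolding constant_on_def by (metis add_diff_cancel_right')
  qed
  then show ?thesis
    using positive_harmonic_constant[OF assms(2,3)] by blast
qed

end
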